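(* Let $n,k,a,b$ be integers such that $n\geq k\geq 0$, $b>a>0$ and $k<b$. For $j=0,1,2,\ldots$ define $D_j=D(n-k+(a-b)j,\ k+bj)$. Then the polynomial $\sum_{j\geq 0} D_j x^j$ has only real zeros.
   Context: The Delannoy number $D(N,K)$ is the number of lattice paths from $(0,0)$ to $(K,N)$ using only east $(1,0)$, north $(0,1)$ and northeast $(1,1)$ steps; equivalently $D(N,0)=D(0,K)=1$ for $N,K\ge 0$ and $D(N,K)=D(N-1,K)+D(N,K-1)+D(N-1,K-1)$ for $N,K\ge 1$. In particular $D(N,K)=0$ if $N<0$ (no such path exists), so only finitely many $D_j$ are nonzero. *)

theory Defs
  imports Complex_Main "HOL-Computational_Algebra.Polynomial"
begin

datatype step = East | North | Northeast

fun dx :: "step \<Rightarrow> int" where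
  "dx East = 1" | "dx North = 0" | "dx Northeast = 1"

fun dy :: "step \<Rightarrow> int" where
  "dy East = 0" | "dy North = 1" | "dy Northeast = 1"

text \<open>A lattice path starting at the origin is identified with its list of steps. The first
  argument is the height (second coordinate) of the endpoint; either argument may be negative, in
  which case there is no path.\<close>

definition delannoy_paths :: "int \<Rightarrow> int \<Rightarrow> step list set" where
  "delannoy_paths N K = {p. sum_list (map dx p) = K \<and> sum_list (map dy p) = N}"

definition delannoy :: "int \<Rightarrow> int \<Rightarrow> nat" where
  "delannoy N K = card (delannoy_paths N K)"

lemma dx_nonneg: "0 \<le> dx s"
  by (cases s) simp_all

lemma dy_nonneg: "0 \<le> dy s"
  by (cases s) simp_all

lemma path_nonneg: "0 \<le> sum_list (map dx p)" "0 \<le> sum_list (map dy p)"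
  by (auto intro!: sum_list_nonneg simp: dx_nonneg dy_nonneg)

lemma length_path_le: "int (length p) \<le> sum_list (map dx p) + sum_list (map dy p)"
proof (induction p)
  case (Cons s p)
  then show ?case by (cases s) auto
qed simp

text \<open>The set of paths is finite, so its cardinality is meaningful.\<close>

lemma finite_delannoy_paths: "finite (delannoy_paths N K)"
proof (rule finite_subset)
  have "finite (UNIV :: step set)"
  proof (rule finite_subset)
    show "UNIV \<subseteq> {East, North, Northeast}"
      using step.exhaust by auto
  qed simp
  then show "finite {p :: step list. set p \<subseteq> UNIV \<and> length p \<le> nat (N + K)}"
    by (rule finite_lists_length_le)
  show "delannoy_paths N K \<subseteq> {p. set p \<subseteq> UNIV \<and> length p \<le> nat (N + K)}"
  proof
    fix p assume "p \<in> delannoy_paths N K"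
    then show "p \<in> {p. set p \<subseteq> UNIV \<and> length p \<le> nat (N + K)}"
      using length_path_le[of p] by (auto simp: delannoy_paths_def)
  qed
qed

lemma delannoy_neg: "N < 0 \<or> K < 0 \<Longrightarrow> delannoy N K = 0"
proof -
  assume "N < 0 \<or> K < 0"
  then have "p \<notin> delannoy_paths N K" for p
    using path_nonneg[of p] by (auto simp: delannoy_paths_def)
  then have "delannoy_paths N K = {}"
    by blast
  then show ?thesis by (simp add: delannoy_def)
qed

lemma delannoy_0_0: "delannoy 0 0 = 1"
proof -
  have "p = []" if "p \<in> delannoy_paths 0 0" for p
    using that length_path_le[of p] by (simp add: delannoy_paths_def)
  then have "delannoy_paths 0 0 = {[]}"
    by (auto simp: delannoy_paths_def)
  then show ?thesis by (simp add: delannoy_def)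
qed

lemma delannoy_rec:
  assumes "N \<noteq> 0 \<or> K \<noteq> 0"
  shows "delannoy N K = delannoy (N - 1) K + delannoy N (K - 1) + delannoy (N - 1) (K - 1)"
proof -
  let ?A = "(#) North ` delannoy_paths (N - 1) K"
  let ?B = "(#) East ` delannoy_paths N (K - 1)"
  let ?C = "(#) Northeast ` delannoy_paths (N - 1) (K - 1)"
  have "delannoy_paths N K = ?A \<union> ?B \<union> ?C"
  proof (intro equalityI subsetI)
    fix p assume p: "p \<in> delannoy_paths N K"
    then obtain s q where sq: "p = s # q"
      using assms by (cases p) (auto simp: delannoy_paths_def)
    show "p \<in> ?A \<union> ?B \<union> ?C"
      using p sq by (cases s) (auto simp: delannoy_paths_def)
  qed (auto simp: delannoy_paths_def)
  moreover have "card (?A \<union> ?B \<union> ?C) = card ?A + card ?B + card ?C"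
    using finite_delannoy_paths
    by (subst card_Un_disjoint, simp, simp, blast, subst card_Un_disjoint, simp, simp, blast, simp)
  moreover have "card ?A = delannoy (N - 1) K" "card ?B = delannoy N (K - 1)"
    "card ?C = delannoy (N - 1) (K - 1)"
    by (simp_all add: delannoy_def card_image)
  ultimately show ?thesis by (simp add: delannoy_def)
qed

lemma delannoy_0_right: "0 \<le> N \<Longrightarrow> delannoy N 0 = 1"
proof (induction N rule: int_ge_induct)
  case (step N)
  then show ?case using delannoy_rec[of "N + 1" 0] by (simp add: delannoy_neg)
qed (rule delannoy_0_0)

lemma delannoy_0_left: "0 \<le> K \<Longrightarrow> delannoy 0 K = 1"
proof (induction K rule: int_ge_induct)
  case (step K)
  then show ?case using delannoy_rec[of 0 "K + 1"] by (simp add: delannoy_neg)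
qed (rule delannoy_0_0)

text \<open>The coefficient sequence along the ray has finite support, so that a sum over its support is
  the whole generating polynomial.\<close>

lemma finite_delannoy_ray:
  fixes n k a b :: int
  assumes "a < b"
  shows "finite {j :: nat. delannoy (n - k + (a - b) * int j) (k + b * int j) \<noteq> 0}"
proof (rule finite_subset)
  show "{j. delannoy (n - k + (a - b) * int j) (k + b * int j) \<noteq> 0} \<subseteq> {..nat (n - k)}"
  proof
    fix j assume "j \<in> {j. delannoy (n - k + (a - b) * int j) (k + b * int j) \<noteq> 0}"
    then have "0 \<le> n - k + (a - b) * int j"
      using delannoy_neg[of "n - k + (a - b) * int j" "k + b * int j"]
      by (cases "n - k + (a - b) * int j < 0") auto
    moreover have "1 * int j \<le> (b - a) * int j"
      using assms by (intro mult_right_mono) auto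
    ultimately show "j \<in> {..nat (n - k)}"
      by (simp add: algebra_simps)
  qed
qed simp

lemma coeff_sum_support:
  fixes D :: "nat \<Rightarrow> nat"
  assumes "finite {j. D j \<noteq> 0}"
  shows "coeff (\<Sum>j | D j \<noteq> 0. monom (of_nat (D j) :: complex) j) i = of_nat (D i)"
  using assms by (simp add: coeff_sum)

end

theory Submission imports Defs begin

text \<open>
  Put \<open>c = b - a\<close> and, for non-real \<open>z\<close>, sum \<open>delannoy (N - c * j) (K + b * j) * z ^ j\<close> over all
  integers \<open>j\<close>. The resulting \<open>G N K\<close> satisfies the Delannoy recurrence away from the line
  \<open>b * N + c * K = 0\<close>, and translating \<open>(N, K)\<close> by \<open>(-c, b)\<close> divides it by \<open>z\<close>. If \<open>z\<close> is in the
  upper half plane, walking south-east in the \<open>(K, N)\<close>-grid from a point to its translate turns the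
  values of \<open>G\<close> monotonically clockwise by at most \<open>arg z < pi\<close>: the recurrence preserves this, as the three values that are added lie in
  a common pointed cone. In such a cone a sum vanishes only if all summands do, so \<open>G N K = 0\<close>
  would propagate down to \<open>G 0 0 = 1\<close>.
\<close>

section \<open>Zero sums in a pointed cone\<close>

text \<open>For nonzero values, each pair of inequalities puts the clockwise angle from the first
  number to the second in [0, arg z]. Since arg z < pi, opposite directions are excluded and nothing
  can cancel.\<close>

lemma Im_cnj_sum3_eq_0:
  fixes u v w z :: complex
  assumes z: "Im z > 0"
    and uv: "Im (u * cnj v) \<ge> 0" "Im (z * (v * cnj u)) \<ge> 0"
    and uw: "Im (u * cnj w) \<ge> 0" "Im (z * (w * cnj u)) \<ge> 0"
    and vw: "Im (v * cnj w) \<ge> 0" "Im (z * (w * cnj v)) \<ge> 0"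
    and sum: "u + v + w = 0"
  shows "u = 0 \<and> v = 0 \<and> w = 0"
proof -
  have w: "w = - u - v"
    using sum by (simp add: algebra_simps add_eq_0_iff)
  have Re_nonneg: "Re (x * cnj y) \<ge> 0" if "Im (x * cnj y) = 0" "Im (z * (y * cnj x)) \<ge> 0" for x y
  proof -
    have "Im (y * cnj x) = 0" "Re (y * cnj x) = Re (x * cnj y)"
      using that(1) by (simp_all add: algebra_simps)
    then have "Im z * Re (x * cnj y) \<ge> 0"
      using that(2) times_complex.sel(2)[of z "y * cnj x"] by (simp add: mult_ac)
    with z show ?thesis
      using zero_le_mult_iff not_le by blast
  qed
  \<comment> \<open>With \<open>w = - u - v\<close>, \<open>Im (u * cnj w)\<close> is the negative
    of \<open>Im (u * cnj v)\<close>; both are nonnegative, hence zero, and the three numbers are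
    collinear.\<close>
  have 0: "Im (u * cnj v) = 0" "Im (u * cnj w) = 0" "Im (v * cnj w) = 0"
    using uv(1) uw(1) vw(1) unfolding w by (simp_all add: algebra_simps)
  have Re: "Re (u * cnj v) \<ge> 0" "Re (u * cnj w) \<ge> 0" "Re (v * cnj w) \<ge> 0"
    using Re_nonneg 0 uv(2) uw(2) vw(2) by blast+
  have "(Re u)\<^sup>2 + (Im u)\<^sup>2 \<le> 0" "(Re v)\<^sup>2 + (Im v)\<^sup>2 \<le> 0"
    using Re unfolding w by (simp_all add: algebra_simps power2_eq_square)
  then have "u = 0" "v = 0"
    by (simp_all add: complex_eq_iff sum_power2_le_zero_iff)
  then show ?thesis
    using w by simp
qed

section \<open>Sums along a line and their recurrence\<close>

locale delannoy_line =
  fixes b c :: int and z :: complex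
  assumes b: "b \<ge> 2" and c: "c \<ge> 1" and z: "Im z > 0"
begin

text \<open>This is the \<open>G\<close> of the overview. Admitting negative \<open>j\<close> makes
  translation by \<open>(-c, b)\<close> an exact index shift.\<close>

definition line_sum :: "int \<Rightarrow> int \<Rightarrow> complex" where
  "line_sum N K = (\<Sum>j | 0 \<le> N - c * j \<and> 0 \<le> K + b * j.
     of_nat (delannoy (N - c * j) (K + b * j)) * z powi j)"

text \<open>Invariant under translation by \<open>(-c, b)\<close>, zero at the translates of the
  origin, and smaller at each of the three predecessors of a point.\<close>

definition level :: "int \<Rightarrow> int \<Rightarrow> int" where
  "level N K = b * N + c * K"

lemma z_nonzero: "z \<noteq> 0"
  using z by auto

lemma finite_line: "finite {j. 0 \<le> N - c * j \<and> 0 \<le> K + b * j}"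
proof (rule finite_subset)
  show "{j. 0 \<le> N - c * j \<and> 0 \<le> K + b * j} \<subseteq> {-\<bar>K\<bar>..\<bar>N\<bar>}"
  proof
    fix j assume "j \<in> {j. 0 \<le> N - c * j \<and> 0 \<le> K + b * j}"
    then have j: "c * j \<le> N" "- K \<le> b * j"
      by auto
    have "j \<le> \<bar>N\<bar>"
    proof (cases "j \<le> 0")
      case False
      then have "1 * j \<le> c * j"
        using c by (intro mult_right_mono) auto
      then show ?thesis
        using j by linarith
    qed simp
    moreover have "- \<bar>K\<bar> \<le> j"
    proof (cases "j \<ge> 0")
      case False
      then have "1 * - j \<le> b * - j"
        using b by (intro mult_right_mono) auto
      then show ?thesis
        using j by linarith
    qed simp
    ultimately show "j \<in> {-\<bar>K\<bar>..\<bar>N\<bar>}"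
      by simp
  qed
qed simp

lemma line_sum_superset:
  assumes "finite A" "{j. 0 \<le> N - c * j \<and> 0 \<le> K + b * j} \<subseteq> A"
  shows "line_sum N K = (\<Sum>j\<in>A. of_nat (delannoy (N - c * j) (K + b * j)) * z powi j)"
  unfolding line_sum_def
  using assms by (intro sum.mono_neutral_left) (auto simp: not_le intro!: delannoy_neg)

lemma line_sum_rec:
  assumes "level N K > 0"
  shows "line_sum N K = line_sum N (K - 1) + line_sum (N - 1) (K - 1) + line_sum (N - 1) K"
proof -
  let ?A = "{j. 0 \<le> N - c * j \<and> 0 \<le> K + b * j}"
  \<comment> \<open>The Delannoy recurrence fails only at the origin, which a line of positive level
    misses.\<close>
  have off_origin: "N - c * j \<noteq> 0 \<or> K + b * j \<noteq> 0" for j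
  proof (rule ccontr)
    assume "\<not> ?thesis"
    then have "N = c * j" "K = - (b * j)"
      by auto
    with assms show False
      by (simp add: level_def)
  qed
  have shift: "N - c * j - 1 = N - 1 - c * j" "K + b * j - 1 = K - 1 + b * j" for j
    by simp_all
  have "delannoy (N - c * j) (K + b * j) = delannoy (N - c * j) (K - 1 + b * j)
      + delannoy (N - 1 - c * j) (K - 1 + b * j) + delannoy (N - 1 - c * j) (K + b * j)" for j
    using delannoy_rec[OF off_origin[of j]] unfolding shift by linarith
  then have "line_sum N K = (\<Sum>j\<in>?A. of_nat (delannoy (N - c * j) (K - 1 + b * j)) * z powi j)
      + (\<Sum>j\<in>?A. of_nat (delannoy (N - 1 - c * j) (K - 1 + b * j)) * z powi j)
      + (\<Sum>j\<in>?A. of_nat (delannoy (N - 1 - c * j) (K + b * j)) * z powi j)"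
    by (simp add: line_sum_def sum.distrib distrib_right)
  \<comment> \<open>\<open>?A\<close> contains the index sets of the three predecessors; the
    additional terms vanish.\<close>
  moreover have "line_sum N (K - 1) = (\<Sum>j\<in>?A. of_nat (delannoy (N - c * j) (K - 1 + b * j)) * z powi j)"
    "line_sum (N - 1) (K - 1) = (\<Sum>j\<in>?A. of_nat (delannoy (N - 1 - c * j) (K - 1 + b * j)) * z powi j)"
    "line_sum (N - 1) K = (\<Sum>j\<in>?A. of_nat (delannoy (N - 1 - c * j) (K + b * j)) * z powi j)"
    by (rule line_sum_superset[OF finite_line], force)+
  ultimately show ?thesis
    by simp
qed

lemma line_sum_shift: "line_sum (N - c) (K + b) * z = line_sum N K"
proof -
  have "line_sum N K = (\<Sum>j | 0 \<le> N - c - c * j \<and> 0 \<le> K + b + b * j.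
     of_nat (delannoy (N - c - c * j) (K + b + b * j)) * z powi (j + 1))"
    unfolding line_sum_def
    by (rule sum.reindex_bij_witness[where i = "\<lambda>j. j + 1" and j = "\<lambda>j. j - 1"])
      (auto simp: algebra_simps)
  also have "\<dots> = line_sum (N - c) (K + b) * z"
    using z_nonzero by (simp add: line_sum_def power_int_add sum_distrib_right mult.assoc)
  finally show ?thesis ..
qed

text \<open>As \<open>b\<close> and \<open>c\<close> are positive, such a line can meet the quadrant
  only at the origin. This settles the base case of \<open>line_sum_clockwise\<close>.\<close>

lemma line_sum_nonpos_level:
  assumes "level N K \<le> 0" "line_sum N K \<noteq> 0"
  shows "\<exists>j. N = c * j \<and> K = - (b * j)"
proof -
  obtain j where j: "0 \<le> N - c * j" "0 \<le> K + b * j"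
    using assms(2) unfolding line_sum_def by (metis (mono_tags, lifting) mem_Collect_eq
      equals0I sum.empty)
  have "b * (N - c * j) + c * (K + b * j) \<le> 0"
    using assms(1) by (simp add: level_def algebra_simps)
  moreover have "b * (N - c * j) \<ge> 0" "c * (K + b * j) \<ge> 0"
    using b c j by simp_all
  ultimately have "b * (N - c * j) = 0" "c * (K + b * j) = 0"
    by linarith+
  then show ?thesis
    using b c by (intro exI[of _ j]) auto
qed

section \<open>Clockwise turning\<close>

lemma line_sum_translate:
  "Im (line_sum N K * cnj (line_sum (N - c) (K + b))) \<ge> 0"
proof -
  have "line_sum N K * cnj (line_sum (N - c) (K + b))
      = z * of_real ((cmod (line_sum (N - c) (K + b)))\<^sup>2)"
    by (simp add: line_sum_shift[symmetric, of N K] complex_norm_square mult_ac del: of_real_power)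
  then show ?thesis
    using z by simp
qed

text \<open>\<open>(N, J)\<close> ranges over the rectangle spanned by \<open>(M, K)\<close> and its
  translate. Expanding either point by the recurrence lowers the sum of the levels; the edges of the
  rectangle decide which point may be expanded.\<close>

lemma line_sum_clockwise:
  assumes "N \<le> M" "M - c \<le> N" "K \<le> J" "J \<le> K + b"
  shows "Im (line_sum M K * cnj (line_sum N J)) \<ge> 0"
  using assms
proof (induction "nat (level M K) + nat (level N J)" arbitrary: M K N J rule: less_induct)
  case less
  have level_pred: "level x (y - 1) < level x y" "level (x - 1) (y - 1) < level x y"
    "level (x - 1) y < level x y" for x y
    using b c by (simp_all add: level_def algebra_simps)
  have add: "Im ((u + v + w) * x) = Im (u * x) + Im (v * x) + Im (w * x)"
    "Im (x * cnj (u + v + w)) = Im (x * cnj u) + Im (x * cnj v) + Im (x * cnj w)" for u v w x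
    by (simp_all add: algebra_simps)
  consider (fst) "level M K > 0" "N < M" "J < K + b"
    | (snd) "level N J > 0" "K < J" "M - c < N"
    | (eq) "M = N" "K = J" | (translate) "N = M - c" "J = K + b"
    | (low) "level M K \<le> 0" "level N J \<le> 0"
  proof -
    \<comment> \<open>On the edges in \<open>1\<close> and \<open>3\<close> the second point cannot
      be expanded, on those in \<open>2\<close> and \<open>4\<close> the first cannot. The other
      point then has the higher level, unless the two coincide or are translates.\<close>
    have 1: "level N J < level M K \<or> (M = N \<and> K = J)" if "K = J"
      using that less.prems b by (auto simp: level_def order.order_iff_strict)
    have 2: "level M K < level N J \<or> (M = N \<and> K = J)" if "M = N"
      using that less.prems c by (auto simp: level_def order.order_iff_strict)
    have 3: "level N J < level M K \<or> (N = M - c \<and> J = K + b)" if "N = M - c"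
    proof -
      have "c * J < c * (K + b)" if "J \<noteq> K + b"
        using that less.prems c by auto
      then show ?thesis
        using that by (auto simp: level_def algebra_simps)
    qed
    have 4: "level M K < level N J \<or> (N = M - c \<and> J = K + b)" if "J = K + b"
    proof -
      have "b * (M - c) < b * N" if "N \<noteq> M - c"
        using that less.prems b by auto
      then show ?thesis
        using that by (auto simp: level_def algebra_simps)
    qed
    show thesis
      using that 1 2 3 4 less.prems by (smt (verit))
  qed
  then show ?case
  proof cases
    case fst
    have "Im (line_sum M (K - 1) * cnj (line_sum N J)) \<ge> 0"
      "Im (line_sum (M - 1) (K - 1) * cnj (line_sum N J)) \<ge> 0"
      "Im (line_sum (M - 1) K * cnj (line_sum N J)) \<ge> 0"
      using fst less.prems level_pred[of M K] by - (rule less.hyps; linarith)+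
    then show ?thesis
      by (simp only: line_sum_rec[OF fst(1)] add)
  next
    case snd
    have "Im (line_sum M K * cnj (line_sum N (J - 1))) \<ge> 0"
      "Im (line_sum M K * cnj (line_sum (N - 1) (J - 1))) \<ge> 0"
      "Im (line_sum M K * cnj (line_sum (N - 1) J)) \<ge> 0"
      using snd less.prems level_pred[of N J] by - (rule less.hyps; linarith)+
    then show ?thesis
      by (simp only: line_sum_rec[OF snd(1)] add)
  next
    case eq
    then show ?thesis
      by (simp add: algebra_simps)
  next
    case translate
    then show ?thesis
      using line_sum_translate by simp
  next
    case low
    show ?thesis
    proof (cases "line_sum M K = 0 \<or> line_sum N J = 0")
      case False
      then obtain i j where ij: "M = c * i" "K = - (b * i)" "N = c * j" "J = - (b * j)"
        using line_sum_nonpos_level low by metis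
      \<comment> \<open>Both points are translates of the origin; the rectangle leaves only equal or
        consecutive indices.\<close>
      have "c * j \<le> c * i" "c * (i - 1) \<le> c * j"
        using less.prems ij by (simp_all add: algebra_simps)
      then have "j = i \<or> j = i - 1"
        using c by auto
      then show ?thesis
      proof
        assume "j = i"
        then show ?thesis
          using ij by (simp add: algebra_simps)
      next
        assume "j = i - 1"
        then have "N = M - c" "J = K + b"
          using ij by (simp_all add: right_diff_distrib)
        then show ?thesis
          using line_sum_translate by simp
      qed
    qed auto
  qed
qed

text \<open>The walk from \<open>(N, J)\<close> on to the translate of \<open>(M, K)\<close> is also
  clockwise, so the turn already made is at most arg z.\<close>

lemma line_sum_cone:
  assumes "N \<le> M" "M - c \<le> N" "K \<le> J" "J \<le> K + b"
  shows "Im (z * (line_sum N J * cnj (line_sum M K))) \<ge> 0"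
proof -
  define v where "v = line_sum (M - c) (K + b)"
  have u: "line_sum M K = v * z"
    by (simp add: v_def line_sum_shift)
  have "Im (line_sum N J * cnj v) \<ge> 0"
    using assms unfolding v_def by (intro line_sum_clockwise) auto
  moreover have "z * (line_sum N J * cnj (line_sum M K))
      = of_real ((cmod z)\<^sup>2) * (line_sum N J * cnj v)"
    by (simp add: u complex_norm_square mult_ac del: of_real_power)
  moreover have "Im (of_real r * x) = r * Im x" for r x
    by simp
  ultimately show ?thesis
    by (metis mult_nonneg_nonneg zero_le_power2)
qed

section \<open>Nonvanishing in the quadrant\<close>

lemma line_sum_rec_eq_0:
  assumes "level N K > 0" "line_sum N K = 0"
  shows "line_sum N (K - 1) = 0 \<and> line_sum (N - 1) (K - 1) = 0 \<and> line_sum (N - 1) K = 0"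
proof (rule Im_cnj_sum3_eq_0[OF z])
  show "line_sum N (K - 1) + line_sum (N - 1) (K - 1) + line_sum (N - 1) K = 0"
    using line_sum_rec assms by simp
\<comment> \<open>In the order listed, the predecessors form a walk one step south, then one step
  east; it fits in the rectangle because \<open>c\<close> and \<open>b\<close> are at least
  1.\<close>
qed (insert b c, (rule line_sum_clockwise line_sum_cone; linarith)+)

lemma line_sum_0_0: "line_sum 0 0 = 1"
proof -
  have "{j. 0 \<le> 0 - c * j \<and> 0 \<le> 0 + b * j} = {0}"
    using b c by (auto simp: mult_le_0_iff zero_le_mult_iff)
  then show ?thesis
    unfolding line_sum_def by (simp add: delannoy_0_0)
qed

lemma line_sum_nonzero:
  assumes "0 \<le> N" "0 \<le> K"
  shows "line_sum N K \<noteq> 0"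
  using assms
proof (induction "nat (N + K)" arbitrary: N K rule: less_induct)
  case less
  show ?case
  proof (cases "N = 0 \<and> K = 0")
    case False
    have *: "b * N \<ge> 0" "c * K \<ge> 0" "N > 0 \<Longrightarrow> b * N > 0" "K > 0 \<Longrightarrow> c * K > 0"
      using less.prems b c by simp_all
    have "level N K > 0"
      using * less.prems False unfolding level_def by linarith
    \<comment> \<open>Off the origin, the west or the south predecessor is still in the
      quadrant.\<close>
    moreover have "line_sum N (K - 1) \<noteq> 0 \<or> line_sum (N - 1) K \<noteq> 0"
      using less.hyps[of N "K - 1"] less.hyps[of "N - 1" K] less.prems False by fastforce
    ultimately show ?thesis
      using line_sum_rec_eq_0 by blast
  qed (simp add: line_sum_0_0)
qed

section \<open>Back to the polynomial\<close>

text \<open>\<open>K < b\<close> makes \<open>K + b * j\<close> negative for all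
  \<open>j < 0\<close>, so no negative power of \<open>z\<close> survives.\<close>

lemma line_sum_conv_ray:
  assumes "K < b"
  shows "line_sum N K = (\<Sum>j | delannoy (N - c * int j) (K + b * int j) \<noteq> 0.
    of_nat (delannoy (N - c * int j) (K + b * int j)) * z ^ j)"
proof -
  have nonneg: "j \<ge> 0" if "0 \<le> K + b * j" for j
  proof (rule ccontr)
    assume "\<not> ?thesis"
    then have "b * j \<le> b * (- 1)"
      using b by (intro mult_left_mono) auto
    with that assms show False
      by simp
  qed
  let ?S = "{j. delannoy (N - c * j) (K + b * j) \<noteq> 0}"
  have sub: "?S \<subseteq> {j. 0 \<le> N - c * j \<and> 0 \<le> K + b * j}"
    using delannoy_neg by (smt (verit) Collect_mono)
  have "line_sum N K = (\<Sum>j\<in>?S. of_nat (delannoy (N - c * j) (K + b * j)) * z powi j)"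
    unfolding line_sum_def by (rule sum.mono_neutral_right[OF finite_line sub]) auto
  also have "\<dots> = (\<Sum>j | delannoy (N - c * int j) (K + b * int j) \<noteq> 0.
    of_nat (delannoy (N - c * int j) (K + b * int j)) * z ^ j)"
  proof (rule sum.reindex_bij_witness[where i = int and j = nat])
    fix j assume j: "j \<in> ?S"
    with sub have "0 \<le> K + b * j"
      by blast
    then have eq: "int (nat j) = j"
      using nonneg[of j] by simp
    with j show "int (nat j) = j"
      "nat j \<in> {j. delannoy (N - c * int j) (K + b * int j) \<noteq> 0}"
      "of_nat (delannoy (N - c * int (nat j)) (K + b * int (nat j))) * z ^ nat j
        = of_nat (delannoy (N - c * j) (K + b * j)) * z powi j"
      using power_int_of_nat[of z "nat j"] by (simp_all only: eq mem_Collect_eq simp_thms)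
  qed simp_all
  finally show ?thesis .
qed

end

theorem theorem2:
  fixes n k a b :: int and D :: "nat \<Rightarrow> nat"
  assumes "n \<ge> k" and "k \<ge> 0" and "b > a" and "a > 0" and "k < b"
    and D: "\<And>j. D j = delannoy (n - k + (a - b) * int j) (k + b * int j)"
  shows "\<forall>z :: complex. poly (\<Sum>j | D j \<noteq> 0. monom (of_nat (D j)) j) z = 0 \<longrightarrow> z \<in> \<real>"
proof -
  have D': "D j = delannoy (n - k - (b - a) * int j) (k + b * int j)" for j
    using D[of j] by (simp add: algebra_simps)
  have upper: "poly (\<Sum>j | D j \<noteq> 0. monom (of_nat (D j)) j) z \<noteq> 0" if "Im z > 0" for z :: complex
  proof -
    interpret delannoy_line b "b - a" z
      using assms that by unfold_locales auto
    have "poly (\<Sum>j | D j \<noteq> 0. monom (of_nat (D j)) j) z = line_sum (n - k) k"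
      using \<open>k < b\<close> by (simp add: line_sum_conv_ray poly_sum poly_monom D')
    then show ?thesis
      using line_sum_nonzero assms by simp
  qed
  show ?thesis
  proof (intro allI impI)
    fix z :: complex
    assume 0: "poly (\<Sum>j | D j \<noteq> 0. monom (of_nat (D j)) j) z = 0"
    \<comment> \<open>The coefficients are real, so conjugation carries the result to the lower half
      plane.\<close>
    have "poly (\<Sum>j | D j \<noteq> 0. monom (of_nat (D j)) j) (cnj z)
        = cnj (poly (\<Sum>j | D j \<noteq> 0. monom (of_nat (D j)) j) z)"
      by (simp add: poly_sum poly_monom)
    then have "\<not> Im z > 0" "\<not> Im (cnj z) > 0"
      using upper[of z] upper[of "cnj z"] 0 by auto
    then show "z \<in> \<real>"
      by (simp add: complex_is_Real_iff)
  qed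
qed

end
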